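(* Let $n\ge 2$. The $n\times n$ unsigned Stirling matrix of first kind $\mathfrak s$ can be factorized as $$\mathfrak s=\left(L_n(n-1)L_{n-1}(n-2)\cdots L_2(1)\right)\left(L_n(n-2)L_{n-1}(n-3)\cdots L_3(1)\right)\cdots\left(L_n(2)L_{n-1}(1)\right)\left(L_n(1)\right),$$ that is, $\mathfrak s$ is the product, from left to right over $m=2,3,\ldots,n$, of the groups $L_n(n-m+1)L_{n-1}(n-m)\cdots L_m(1)$.
   Context: Let $(x)_0=1$ and $(x)_k=x(x-1)\cdots(x-k+1)$ for a positive integer $k$. The Stirling numbers of first kind $s(n,k)$ are defined by $(x)_n=\sum_{k=0}^{n}s(n,k)x^k$. The $n\times n$ unsigned Stirling matrix of first kind $\mathfrak s=[\mathfrak s_{ij}]_{i,j=1}^{n}$ is defined by $\mathfrak s_{ij}=(-1)^{i-j}s(i,j)$ if $i\ge j$ and $\mathfrak s_{ij}=0$ otherwise. Let $E_{i,j}$ be the $n\times n$ matrix whose $(i,j)$th entry is $1$ and all others are $0$. For a complex number $s$ and $2\le i\le n$, $L_i(s)=I+sE_{i,i-1}$. *)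

theory Defs
  imports
    Complex_Main
    "HOL-Computational_Algebra.Polynomial"
    "Jordan_Normal_Form.Matrix"
begin

definition falling_fact :: "'a::comm_ring_1 \<Rightarrow> nat \<Rightarrow> 'a" where
  "falling_fact x k = (\<Prod>i<k. x - of_nat i)"

(* s(n,k) is read off as the coefficient of x^k in the polynomial (x)_n, where x is the
   indeterminate; lemma falling_fact_eq_sum_stirling1 is the defining expansion. *)
definition stirling1 :: "nat \<Rightarrow> nat \<Rightarrow> int" where
  "stirling1 n k = coeff (falling_fact [:0, 1:] n) k"

lemma degree_falling_fact: "degree (falling_fact ([:0, 1:] :: int poly) n) \<le> n"
proof (induction n)
  case (Suc n)
  have "degree (falling_fact [:0, 1:] n * ([:0, 1:] - of_nat n :: int poly))
      \<le> n + degree ([:0, 1:] - of_nat n :: int poly)"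
    using Suc degree_mult_le[of "falling_fact [:0, 1:] n" "[:0, 1:] - of_nat n :: int poly"]
    by linarith
  also have "degree ([:0, 1:] - of_nat n :: int poly) \<le> 1"
    by (simp add: of_nat_poly)
  finally show ?case
    by (simp add: falling_fact_def)
qed (simp add: falling_fact_def)

lemma falling_fact_eq_sum_stirling1:
  "falling_fact x n = (\<Sum>k=0..n. of_int (stirling1 n k) * x ^ k)"
  for x :: "'a::comm_ring_1"
proof -
  define p where "p = falling_fact ([:0, 1:] :: int poly) n"
  have "degree (map_poly of_int p :: 'a poly) \<le> n"
    using degree_falling_fact[of n]
    by (intro degree_le) (auto simp: p_def coeff_map_poly coeff_eq_0)
  then have "poly (map_poly of_int p) x = (\<Sum>k\<le>n. coeff (map_poly of_int p) k * x ^ k)"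
    unfolding poly_altdef
    by (intro sum.mono_neutral_left) (auto simp: coeff_eq_0)
  moreover have "poly (map_poly of_int (falling_fact ([:0, 1:] :: int poly) m)) x = falling_fact x m"
    for m
  proof (induction m)
    case (Suc m)
    have "(map_poly of_int (falling_fact ([:0, 1:] :: int poly) (Suc m)) :: 'a poly)
        = map_poly of_int (falling_fact [:0, 1:] m) * [:- of_nat m, 1:]"
      by (rule poly_eqI)
         (simp add: falling_fact_def coeff_map_poly of_nat_poly mult.commute[of _ "[:_, _:]"]
           coeff_pCons split: nat.splits)
    then show ?case
      using Suc by (simp add: falling_fact_def) (simp add: algebra_simps)
  qed (simp add: falling_fact_def)
  ultimately show ?thesis
    by (simp add: p_def stirling1_def atMost_atLeast0 coeff_map_poly)
qed

(* Library matrices have indices 0..<n, so the entry (i,j) of the mathematical matrix,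
   1 <= i,j <= n, is stored at (i - 1, j - 1). *)
definition mat_of_entries :: "nat \<Rightarrow> (nat \<Rightarrow> nat \<Rightarrow> complex) \<Rightarrow> complex mat" where
  "mat_of_entries n a = mat n n (\<lambda>(i, j). a (i + 1) (j + 1))"

definition unsigned_stirling1_mat :: "nat \<Rightarrow> complex mat" where
  "unsigned_stirling1_mat n =
     mat_of_entries n (\<lambda>i j. if i \<ge> j then (-1) ^ (i - j) * of_int (stirling1 i j) else 0)"

definition E_mat :: "nat \<Rightarrow> nat \<Rightarrow> nat \<Rightarrow> complex mat" where
  "E_mat n i j = mat_of_entries n (\<lambda>k l. if k = i \<and> l = j then 1 else 0)"

definition L_mat :: "nat \<Rightarrow> nat \<Rightarrow> complex \<Rightarrow> complex mat" where
  "L_mat n i s = 1\<^sub>m n + s \<cdot>\<^sub>m E_mat n i (i - 1)"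

(* The product, from left to right, of a list of n x n matrices. *)
definition mat_prod_list :: "nat \<Rightarrow> complex mat list \<Rightarrow> complex mat" where
  "mat_prod_list n As = foldr (*) As (1\<^sub>m n)"

end

theory Submission
  imports Defs "HOL-Combinatorics.Stirling"
begin

text \<open>Write \<open>c(i,j)\<close> for the unsigned Stirling numbers of the first kind and let \<open>P\<^sub>k\<close> be the
  block matrix \<open>I \<oplus> c\<close>, with an identity block of size \<open>k - 2\<close> followed by the Stirling matrix of
  size \<open>n - k + 2\<close>. Thus \<open>P\<^sub>2\<close> is the full Stirling matrix and \<open>P\<^sub>n\<^sub>+\<^sub>1\<close> is the identity, and it
  suffices to see that multiplying \<open>P\<^sub>m\<^sub>+\<^sub>1\<close> from the left by the group
  \<open>L\<^sub>n(n-m+1) \<cdots> L\<^sub>m(1)\<close> gives \<open>P\<^sub>m\<close>.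

  Left multiplication by \<open>L\<^sub>i(s)\<close> adds \<open>s\<close> times row \<open>i - 1\<close> to row \<open>i\<close>. The rightmost factor of a
  group acts first, so the rows are updated from the top down, and each update uses a row
  \<open>i - 1\<close> that has already reached its final value. The group therefore turns row \<open>i\<close> into the
  old row \<open>i\<close> plus \<open>i - m + 1\<close> times the new row \<open>i - 1\<close>. In the coordinates of the block
  this is the recurrence \<open>c(p+1,q+1) = c(p,q) + p c(p,q+1)\<close>, where the old row, belonging to a
  block that starts one index later, supplies \<open>c(p,q)\<close> (lemma \<open>stirling_block_rec\<close>).\<close>

lemma stirling1_0: "stirling1 0 k = of_bool (k = 0)"
  by (simp add: stirling1_def falling_fact_def)

lemma stirling1_Suc:
  "stirling1 (Suc n) k = (case k of 0 \<Rightarrow> 0 | Suc j \<Rightarrow> stirling1 n j) - int n * stirling1 n k"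
  by (simp add: stirling1_def falling_fact_def of_nat_poly mult.commute[of _ "[:_, _:]"]
      coeff_pCons split: nat.splits)

text \<open>Multiplying \<open>(x)\<^sub>n\<close> by \<open>x - n\<close> gives the recurrence of the combinatorial numbers up to the
  sign of its second term; that sign is absorbed by \<open>(-1)\<^sup>n\<^sup>+\<^sup>k\<close>.\<close>

lemma stirling1_eq_stirling: "stirling1 n k = (-1) ^ (n + k) * int (stirling n k)"
proof (induction n arbitrary: k)
  case 0
  then show ?case by (cases k) (simp_all add: stirling1_0)
next
  case (Suc n)
  show ?case
  proof (cases k)
    case 0
    then show ?thesis using Suc[of 0] by (cases n) (simp_all add: stirling1_Suc)
  next
    case (Suc j)
    then show ?thesis using Suc.IH[of j] Suc.IH[of k]
      by (simp add: stirling1_Suc algebra_simps)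
  qed
qed

lemma mat_of_entries_cong:
  assumes "\<And>i j. 1 \<le> i \<Longrightarrow> i \<le> n \<Longrightarrow> 1 \<le> j \<Longrightarrow> j \<le> n \<Longrightarrow> a i j = b i j"
  shows "mat_of_entries n a = mat_of_entries n b"
  unfolding mat_of_entries_def using assms by (intro eq_matI) auto

lemma unsigned_stirling1_mat_eq:
  "unsigned_stirling1_mat n = mat_of_entries n (\<lambda>i j. of_nat (stirling i j))"
  unfolding unsigned_stirling1_mat_def
proof (rule mat_of_entries_cong)
  fix i j :: nat
  show "(if i \<ge> j then (-1) ^ (i - j) * of_int (stirling1 i j) else 0 :: complex)
      = of_nat (stirling i j)"
  proof (cases "i \<ge> j")
    case True
    have "(-1 :: complex) ^ (i - j) * (-1) ^ (i + j) = (-1) ^ (2 * i)"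
      using True by (simp flip: power_add)
    then show ?thesis using True by (simp add: stirling1_eq_stirling flip: mult.assoc)
  qed simp
qed

lemma mat_of_entries_carrier [simp]: "mat_of_entries n a \<in> carrier_mat n n"
  by (simp add: mat_of_entries_def)

lemma L_mat_carrier [simp]: "L_mat n i s \<in> carrier_mat n n"
  by (simp add: L_mat_def E_mat_def)

lemma one_mat_eq_mat_of_entries: "1\<^sub>m n = mat_of_entries n (\<lambda>i j. of_bool (i = j))"
  by (intro eq_matI) (auto simp: mat_of_entries_def)

lemma E_mat_mult:
  assumes "1 \<le> j" "j \<le> n"
  shows "E_mat n i j * mat_of_entries n a = mat_of_entries n (\<lambda>k l. if k = i then a j l else 0)"
proof (rule eq_matI)
  fix k l
  assume "k < dim_row (mat_of_entries n (\<lambda>k l. if k = i then a j l else 0))"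
    and "l < dim_col (mat_of_entries n (\<lambda>k l. if k = i then a j l else 0))"
  then have kl: "k < n" "l < n" by (simp_all add: mat_of_entries_def)
  have "(E_mat n i j * mat_of_entries n a) $$ (k, l)
      = (\<Sum>t = 0..<n. (if k + 1 = i \<and> t + 1 = j then 1 else 0) * a (t + 1) (l + 1))"
    using kl by (simp add: E_mat_def mat_of_entries_def scalar_prod_def)
  also have "\<dots> = (\<Sum>t = 0..<n. if t = j - 1 then (if k + 1 = i then a j (l + 1) else 0) else 0)"
    using assms by (intro sum.cong) auto
  also have "\<dots> = (if k + 1 = i then a j (l + 1) else 0)"
    using assms by (subst sum.delta) auto
  finally show "(E_mat n i j * mat_of_entries n a) $$ (k, l)
      = mat_of_entries n (\<lambda>k l. if k = i then a j l else 0) $$ (k, l)"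
    using kl by (simp add: mat_of_entries_def)
qed (simp_all add: E_mat_def mat_of_entries_def)

lemma L_mat_mult:
  assumes "2 \<le> i" "i \<le> n"
  shows "L_mat n i s * mat_of_entries n a
    = mat_of_entries n (\<lambda>k l. if k = i then a i l + s * a (i - 1) l else a k l)"
proof -
  have E: "E_mat n i (i - 1) \<in> carrier_mat n n" by (simp add: E_mat_def)
  have "L_mat n i s * mat_of_entries n a
      = mat_of_entries n a + s \<cdot>\<^sub>m (E_mat n i (i - 1) * mat_of_entries n a)"
    unfolding L_mat_def
    by (subst add_mult_distrib_mat[of _ n n _ _ n],
        use E in \<open>simp_all add: mult_smult_assoc_mat[of _ n n _ n] left_mult_one_mat[of _ n n]\<close>)
  also have "\<dots> = mat_of_entries n (\<lambda>k l. if k = i then a i l + s * a (i - 1) l else a k l)"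
    using assms by (subst E_mat_mult) (auto simp: mat_of_entries_def)
  finally show ?thesis .
qed

lemma mat_prod_list_carrier:
  assumes "set As \<subseteq> carrier_mat n n"
  shows "mat_prod_list n As \<in> carrier_mat n n"
  using assms by (induction As) (auto simp: mat_prod_list_def)

lemma mat_prod_list_mult:
  assumes "set As \<subseteq> carrier_mat n n" "B \<in> carrier_mat n n"
  shows "mat_prod_list n As * B = foldr (*) As B"
  using assms
proof (induction As)
  case Nil
  then show ?case by (simp add: mat_prod_list_def)
next
  case (Cons A As)
  then have "mat_prod_list n As \<in> carrier_mat n n" by (intro mat_prod_list_carrier) auto
  then have "A * mat_prod_list n As * B = A * (mat_prod_list n As * B)"
    using Cons.prems by (intro assoc_mult_mat[of _ n n _ n _ n]) auto
  then show ?case using Cons by (simp add: mat_prod_list_def)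
qed

text \<open>The entries of \<open>P\<^sub>k\<close>. Rows of the lower block have positive first Stirling index, so for
  columns left of the block the truncated difference \<open>j + 2 - k = 0\<close> yields the required zero.\<close>

definition stirling_block :: "nat \<Rightarrow> nat \<Rightarrow> nat \<Rightarrow> complex" where
  "stirling_block k i j =
     (if i + 1 < k then of_bool (i = j) else of_nat (stirling (i + 2 - k) (j + 2 - k)))"

text \<open>Even the row \<open>m - 1\<close>, which lies in the identity part of \<open>P\<^sub>m\<^sub>+\<^sub>1\<close> but opens the
  Stirling block of \<open>P\<^sub>m\<close>, is the same in both matrices, because \<open>c(1,q)\<close> vanishes unless \<open>q = 1\<close>.
  This is why a group need not touch it.\<close>

lemma stirling_block_above:
  assumes "i < m" "2 \<le> m"
  shows "stirling_block (Suc m) i j = stirling_block m i j"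
proof (cases "i + 1 = m")
  case True
  have "stirling 1 q = of_bool (q = 1)" for q
    by (cases q rule: nat.exhaust; cases "q - 1") auto
  then show ?thesis using True assms by (auto simp: stirling_block_def)
qed (use assms in \<open>auto simp: stirling_block_def\<close>)

lemma stirling_block_rec:
  assumes "m \<le> i" "2 \<le> m"
  shows "stirling_block m i j
    = stirling_block (Suc m) i j + of_nat (i - m + 1) * stirling_block m (i - 1) j"
proof -
  define p where "p = i - m"
  have i: "i = m + p" using assms by (simp add: p_def)
  show ?thesis
  proof (cases "j + 1 < m")
    case True
    then show ?thesis using assms by (simp add: stirling_block_def i Suc_diff_le)
  next
    case False
    define q where "q = j + 1 - m"
    have q: "j + 2 - m = Suc q" "j + 2 - Suc m = q" using False by (simp_all add: q_def)
    have p: "i + 2 - m = Suc (Suc p)" "i + 2 - Suc m = Suc p" "i - 1 + 2 - m = Suc p"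
      "i - m + 1 = Suc p" using assms by (simp_all add: i)
    have c: "\<not> i + 1 < m" "\<not> i + 1 < Suc m" "\<not> i - 1 + 1 < m" using assms by auto
    have "stirling (Suc (Suc p)) (Suc q) = stirling (Suc p) q + Suc p * stirling (Suc p) (Suc q)"
      by simp
    then show ?thesis
      unfolding stirling_block_def p q by (simp only: c if_False of_nat_add of_nat_mult)
  qed
qed

text \<open>After the factors with index below \<open>r\<close> have acted, the rows above \<open>r\<close> have their final
  values and the others are untouched.\<close>

lemma group_mult_stirling_block_partial:
  assumes "2 \<le> m" "m \<le> r" "r \<le> n + 1"
  shows "foldr (*) (map (\<lambda>i. L_mat n i (of_nat (i - m + 1))) (rev [m..<r]))
      (mat_of_entries n (stirling_block (Suc m)))
    = mat_of_entries n (\<lambda>i j. stirling_block (if i < r then m else Suc m) i j)"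
  using assms(2,3)
proof (induction r rule: dec_induct)
  case base
  show ?case using assms(1) by (auto intro!: mat_of_entries_cong simp: stirling_block_above)
next
  case (step r)
  have "foldr (*) (map (\<lambda>i. L_mat n i (of_nat (i - m + 1))) (rev [m..<Suc r]))
      (mat_of_entries n (stirling_block (Suc m)))
    = L_mat n r (of_nat (r - m + 1))
      * mat_of_entries n (\<lambda>i j. stirling_block (if i < r then m else Suc m) i j)"
    using step by simp
  also have "\<dots> = mat_of_entries n (\<lambda>i j. stirling_block (if i < Suc r then m else Suc m) i j)"
    using step assms(1)
    by (subst L_mat_mult) (auto intro!: mat_of_entries_cong simp: stirling_block_rec[of m r])
  finally show ?case .
qed

lemma group_mult_stirling_block:
  assumes "2 \<le> m" "m \<le> n"
  shows "mat_prod_list n (map (\<lambda>i. L_mat n i (of_nat (i - m + 1))) (rev [m..<n + 1]))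
      * mat_of_entries n (stirling_block (Suc m))
    = mat_of_entries n (stirling_block m)"
proof -
  have "mat_prod_list n (map (\<lambda>i. L_mat n i (of_nat (i - m + 1))) (rev [m..<n + 1]))
      * mat_of_entries n (stirling_block (Suc m))
    = foldr (*) (map (\<lambda>i. L_mat n i (of_nat (i - m + 1))) (rev [m..<n + 1]))
      (mat_of_entries n (stirling_block (Suc m)))"
    by (rule mat_prod_list_mult) auto
  also have "\<dots> = mat_of_entries n (\<lambda>i j. stirling_block (if i < n + 1 then m else Suc m) i j)"
    using assms by (intro group_mult_stirling_block_partial) auto
  also have "\<dots> = mat_of_entries n (stirling_block m)"
    by (rule mat_of_entries_cong) auto
  finally show ?thesis .
qed

lemma groups_prod_eq_stirling_block:
  assumes "2 \<le> k" "k \<le> n + 1"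
  shows "mat_prod_list n
      (map (\<lambda>m. mat_prod_list n
               (map (\<lambda>i. L_mat n i (of_nat (i - m + 1))) (rev [m..<n + 1])))
           [k..<n + 1])
    = mat_of_entries n (stirling_block k)"
  using assms(2,1)
proof (induction k rule: inc_induct)
  case base
  \<comment> \<open>The block of size 1 that remains is the first row of the Stirling matrix.\<close>
  have "stirling_block (n + 1) i j = of_bool (i = j)" if "i \<le> n" for i j
    using that base stirling_block_above[of i "n + 1" j] by (simp add: stirling_block_def)
  then show ?case
    by (auto simp: mat_prod_list_def one_mat_eq_mat_of_entries intro!: mat_of_entries_cong)
next
  case (step k)
  then show ?case
    using group_mult_stirling_block[of k n]
    by (simp add: upt_conv_Cons[of k "Suc n"] mat_prod_list_def del: upt_Suc)
qed

theorem proposition3p1: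
  fixes n :: nat
  assumes "n \<ge> 2"
  shows "unsigned_stirling1_mat n =
    mat_prod_list n
      (map (\<lambda>m. mat_prod_list n
               (map (\<lambda>i. L_mat n i (of_nat (i - m + 1))) (rev [m..<n + 1])))
           [2..<n + 1])"
proof -
  have "unsigned_stirling1_mat n = mat_of_entries n (stirling_block 2)"
    unfolding unsigned_stirling1_mat_eq by (simp add: stirling_block_def mat_of_entries_def)
  with groups_prod_eq_stirling_block[of 2 n] assms show ?thesis by simp
qed

end
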